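(* Let $A,B\in\mathbb{R}$ with $-1\le B<A\le 1$, let $f\in\mathcal{C}(A,B)$, $f(z)=z+\sum_{n\ge 2}a_nz^n$, and let $\Gamma_1,\Gamma_2$ be the first two logarithmic inverse coefficients of $f$. Then $$|\Gamma_2|-|\Gamma_1|\le\frac{A-B}{12},$$ $$|\Gamma_1|-|\Gamma_2|\le\begin{cases}\dfrac{A-B}{4}\Big(1-\dfrac{|5A-B|}{12}\Big), & |5A-B|\le2,\\[2mm] \dfrac{A-B}{2\sqrt{|5A-B|+4}}, & |5A-B|\ge5,\\[2mm] \dfrac{A-B}{12}\Big(1+\dfrac{9}{|5A-B|+4}\Big), & \text{otherwise}.\end{cases}$$ All these inequalities are sharp.
   Context: Let $\mathbb{D}=\{z\in\mathbb{C}:|z|<1\}$ and let $\mathcal{A}$ be the class of holomorphic functions $f$ on $\mathbb{D}$ with $f(0)=0$, $f'(0)=1$, i.e. $f(z)=z+\sum_{n=2}^\infty a_nz^n$. For holomorphic $g,h$ on $\mathbb{D}$, $g\prec h$ (subordination) means there is a holomorphic $\omega:\mathbb{D}\to\mathbb{D}$ with $\omega(0)=0$ and $g=h\circ\omega$. For $-1\le B<A\le1$, the Janowski convex class is $$\mathcal{C}(A,B)=\Big\{f\in\mathcal{A}: 1+\frac{zf''(z)}{f'(z)}\prec\frac{1+Az}{1+Bz}\Big\}.$$ Functions in $\mathcal{C}(A,B)$ are univalent. The logarithmic inverse coefficients $\Gamma_n$ of $f$ are defined by $\log\frac{f^{-1}(w)}{w}=2\sum_{n=1}^\infty\Gamma_nw^n$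 for $|w|<1/4$; in particular $\Gamma_1=-\frac12a_2$ and $\Gamma_2=-\frac12\big(a_3-\frac32a_2^2\big)$. "Sharp" means that for each admissible $(A,B)$ (falling in the indicated case) there is a function $f\in\mathcal{C}(A,B)$ for which equality holds in the corresponding inequality. *)

theory Defs
  imports "HOL-Complex_Analysis.Complex_Analysis"
begin

abbreviation udisc :: "complex set" where
  "udisc \<equiv> ball 0 1"

definition normalized_class :: "(complex \<Rightarrow> complex) set" where
  "normalized_class = {f. f holomorphic_on udisc \<and> f 0 = 0 \<and> deriv f 0 = 1}"

definition subordinate :: "(complex \<Rightarrow> complex) \<Rightarrow> (complex \<Rightarrow> complex) \<Rightarrow> bool" where
  "subordinate g h \<longleftrightarrow>
     g holomorphic_on udisc \<and> h holomorphic_on udisc \<and>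
     (\<exists>\<omega>. \<omega> holomorphic_on udisc \<and> \<omega> ` udisc \<subseteq> udisc \<and> \<omega> 0 = 0 \<and>
          (\<forall>z\<in>udisc. g z = h (\<omega> z)))"

(* The convention x / 0 = 0 admits no extra functions: at a zero of f' in the disc (which is
   not 0, as f'(0) = 1) the quotient z f''(z) / f'(z) has a pole, so the left-hand function is
   not holomorphic on the disc, whatever value it is given at that point. *)
definition janowski_convex :: "real \<Rightarrow> real \<Rightarrow> (complex \<Rightarrow> complex) set" where
  "janowski_convex A B =
     {f \<in> normalized_class.
        subordinate (\<lambda>z. 1 + z * deriv (deriv f) z / deriv f z)
                    (\<lambda>z. (1 + of_real A * z) / (1 + of_real B * z))}"

(* The holomorphic branch on |w| < 1/4 of log (f^{-1}(w) / w) that vanishes at w = 0, where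
   f^{-1}(w) / w has the removable value 1. It is determined on that disc only. *)
definition log_inverse :: "(complex \<Rightarrow> complex) \<Rightarrow> complex \<Rightarrow> complex" where
  "log_inverse f =
     (SOME L. L holomorphic_on ball 0 (1/4) \<and> L 0 = 0 \<and>
        (\<forall>w \<in> ball 0 (1/4) - {0}. exp (L w) = the_inv_into udisc f w / w))"

(* The index 0 entry is the constant term, which is 0. *)
definition log_inv_coeff :: "(complex \<Rightarrow> complex) \<Rightarrow> nat \<Rightarrow> complex" where
  "log_inv_coeff f =
     (THE \<Gamma>. \<Gamma> 0 = 0 \<and>
        (\<forall>w \<in> ball 0 (1/4). (\<lambda>n. 2 * \<Gamma> n * w ^ n) sums log_inverse f w))"

end

theory Submission
  imports Defs
begin

text \<open>
Let \<open>\<omega>\<close> be the Schwarz function that realises the subordination for \<open>f\<close>, with Taylor coefficients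
\<open>c\<^sub>1\<close> and \<open>c\<^sub>2\<close>. Then \<open>f'' / f'\<close> is an explicit expression in \<open>\<omega>\<close>, and a comparison of
coefficients gives

  \<open>\<Gamma>\<^sub>1 = - (A - B) / 4 * c\<^sub>1\<close> and \<open>\<Gamma>\<^sub>2 = - (A - B) / 12 * (c\<^sub>2 - (5 A - B) / 4 * c\<^sub>1\<^sup>2)\<close>.

The coefficients satisfy \<open>\<bar>c\<^sub>2\<bar> \<le> 1 - \<bar>c\<^sub>1\<bar>\<^sup>2\<close> (lemma \<open>Schwarz_Pick_at_0\<close>), so both
differences are bounded by functions of \<open>x = \<bar>c\<^sub>1\<bar> \<in> [0, 1]\<close> and of \<open>t = \<bar>5 A - B\<bar> \<le> 6\<close>. The first one is
largest at \<open>x = 0\<close>. The second one leads to maximising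
\<open>3 x - max 0 ((t + 4) / 4 * x\<^sup>2 - 1)\<close>; its three cases say whether the maximum is at the end point
\<open>x = 1\<close>, at the vertex of the parabola or at the kink (lemmas \<open>profile_le_bound\<close> and
\<open>profile_bound_attained\<close>). The bounds are sharp because the Schwarz functions
\<open>z (x + \<sigma> z) / (1 + \<sigma> x z)\<close> with suitable \<open>x\<close> and \<open>\<sigma>\<close> attain them, and each Schwarz function belongs to a member
of the class (lemma \<open>janowski_convexI\<close>).

The coefficients are defined through the inverse function on the disc of radius \<open>1/4\<close>, so one has to know
that \<open>f\<close> takes each value \<open>w\<close> of this disc exactly once. This follows from convexity by a
fixed point argument. Two applications of Jack's lemma give
\<open>\<bar>f / (z f') - 1\<bar> < 1\<close> and then \<open>\<bar>z / f - 1\<bar> < 1\<close>. The equation \<open>f z = w\<close> is the fixed point equation of the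
map sending \<open>z\<close> to \<open>w * (z / f z)\<close>, and the last bound makes this map a contraction for \<open>\<bar>w\<bar> < 1/4\<close>
(lemma \<open>unique_preimage\<close>). Moreover \<open>z / f\<close> then lies in the right half plane, so the logarithm of
\<open>f^{-1}(w) / w\<close> is a principal logarithm; its derivative is expressed by \<open>f / (z f')\<close>
(lemma \<open>ell_ode\<close>), which is how the coefficients are computed.
\<close>

section \<open>The Schwarz lemma at interior and boundary points\<close>

text \<open>
Jack's lemma (a boundary Schwarz lemma). The rescaled map \<open>u \<zeta> = \<omega> (z0 * \<zeta>) / \<omega> z0\<close>
satisfies \<open>\<bar>u \<zeta>\<bar> \<le> \<bar>\<zeta>\<bar>\<close> by the Schwarz lemma and fixes 1. Comparing both sides to first order along
every ray \<open>1 + t * d\<close> that enters the disc gives \<open>Re (u' 1 * d) \<le> Re d\<close>, and this for the whole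
half plane \<open>Re d < 0\<close> leaves only real values \<open>u' 1 \<ge> 1\<close>.
\<close>

lemma Jack_derivative:
  fixes \<omega> :: "complex \<Rightarrow> complex"
  assumes hol: "\<omega> holomorphic_on ball 0 1" and \<omega>0: "\<omega> 0 = 0"
    and z0: "cmod z0 < 1" and on: "cmod (\<omega> z0) = 1"
    and inside: "\<And>z. cmod z < cmod z0 \<Longrightarrow> cmod (\<omega> z) < 1"
  obtains k :: real where "1 \<le> k" "z0 * deriv \<omega> z0 = of_real k * \<omega> z0"
proof -
  have z0nz: "z0 \<noteq> 0" using on \<omega>0 by auto
  have \<omega>nz: "\<omega> z0 \<noteq> 0" using on by auto
  define u where "u \<zeta> = \<omega> (z0 * \<zeta>) / \<omega> z0" for \<zeta>
  define K where "K = z0 * deriv \<omega> z0 / \<omega> z0"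
  have small: "cmod (z0 * \<zeta>) < cmod z0" if "cmod \<zeta> < 1" for \<zeta>
    using that z0nz by (simp add: norm_mult)
  have u_le: "cmod (u \<zeta>) \<le> cmod \<zeta>" if "cmod \<zeta> < 1" for \<zeta>
  proof (rule Schwarz_Lemma(1)[OF _ _ _ that])
    have "(\<lambda>\<zeta>. \<omega> (z0 * \<zeta>)) holomorphic_on ball 0 1"
      by (rule holomorphic_on_compose_gen[OF _ hol, unfolded o_def])
        (use order.strict_trans[OF small z0] in \<open>auto intro!: holomorphic_intros\<close>)
    then show "u holomorphic_on ball 0 1"
      unfolding u_def using \<omega>nz by (intro holomorphic_intros) auto
    show "u 0 = 0" by (simp add: u_def \<omega>0)
    show "cmod (u z) < 1" if "cmod z < 1" for z
      using inside[OF small[OF that]] by (simp add: u_def norm_divide on)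
  qed
  have "(\<omega> has_field_derivative deriv \<omega> z0) (at z0)"
    using holomorphic_derivI[OF hol, of z0] z0 by simp
  then have "(\<omega> has_field_derivative deriv \<omega> z0) (at (z0 * 1))" by simp
  then have du: "(u has_field_derivative K) (at 1)"
    unfolding u_def K_def
    by (auto intro!: derivative_eq_intros DERIV_chain2[where f=\<omega>] simp: \<omega>nz)
  have u1: "u 1 = 1" using \<omega>nz by (simp add: u_def)
  have dir: "Re (K * d) \<le> Re d" if d: "Re d < 0" for d
  proof (rule ccontr)
    assume neg: "\<not> ?thesis"
    \<comment> \<open>The quadratic majorant \<open>(1 + \<bar>y\<bar>\<^sup>2) / 2\<close> of \<open>\<bar>y\<bar>\<close> has the same derivative at \<open>y = 1\<close>
      and is polynomial in \<open>t\<close>.\<close>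
    define \<psi> where "\<psi> t = Re (u (1 + of_real t * d)) - (1 + t * Re d + t\<^sup>2 * (cmod d)\<^sup>2 / 2)" for t
    have "((\<lambda>t. 1 + of_real t * d) has_vector_derivative d) (at (0::real))"
      by (auto intro!: derivative_eq_intros)
    from field_vector_diff_chain_at[OF this, of u K] du
    have "((\<lambda>t. u (1 + of_real t * d)) has_vector_derivative d * K) (at (0::real))"
      by (simp add: o_def)
    from bounded_linear.has_vector_derivative[OF bounded_linear_Re this]
    have "((\<lambda>t. Re (u (1 + of_real t * d))) has_real_derivative Re (d * K)) (at (0::real))"
      by (simp add: has_real_derivative_iff_has_vector_derivative)
    then have "(\<psi> has_real_derivative (Re (d * K) - Re d)) (at 0)"
      unfolding \<psi>_def by (rule DERIV_diff) (auto intro!: derivative_eq_intros)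
    moreover have "0 < Re (d * K) - Re d" using neg by (simp add: mult.commute)
    ultimately obtain e where e: "0 < e" "\<And>t. 0 < t \<Longrightarrow> t < e \<Longrightarrow> \<psi> 0 < \<psi> (0 + t)"
      using DERIV_pos_inc_right[of \<psi> "Re (d * K) - Re d" 0] by auto
    have dnz: "d \<noteq> 0" using d by auto
    \<comment> \<open>The second bound on \<open>t\<close> keeps \<open>1 + t * d\<close> inside the unit disc.\<close>
    define t where "t = min (e / 2) (- Re d / (cmod d)\<^sup>2)"
    have t: "0 < t" "t < e" "t * (cmod d)\<^sup>2 \<le> - Re d"
      using e d dnz by (auto simp: t_def field_simps min_def)
    have sq: "(cmod (1 + of_real t * d))\<^sup>2 = 1 + 2 * (t * Re d) + t\<^sup>2 * (cmod d)\<^sup>2"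
      unfolding cmod_power2 by (simp add: power2_eq_square algebra_simps)
    have "t * (t * (cmod d)\<^sup>2) \<le> t * (- Re d)" using t by (intro mult_left_mono) auto
    then have "(cmod (1 + of_real t * d))\<^sup>2 \<le> 1 + t * Re d"
      unfolding sq by (simp add: power2_eq_square algebra_simps)
    also have "\<dots> < 1" using t d by (simp add: mult_pos_neg)
    finally have "cmod (1 + of_real t * d) < 1"
      by (simp add: power2_less_imp_less abs_square_less_1)
    from u_le[OF this] have "Re (u (1 + of_real t * d)) \<le> cmod (1 + of_real t * d)"
      using complex_Re_le_cmod order_trans by blast
    also have "\<dots> \<le> (1 + (cmod (1 + of_real t * d))\<^sup>2) / 2"
      using sum_squares_bound[of 1 "cmod (1 + of_real t * d)"] by simp
    finally have "\<psi> t \<le> 0" unfolding \<psi>_def sq by (simp add: field_simps)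
    moreover have "\<psi> 0 < \<psi> t" using e(2)[OF t(1,2)] by simp
    ultimately show False by (simp add: \<psi>_def u1)
  qed
  have ReK: "1 \<le> Re K" using dir[of "-1"] by simp
  have ImK: "s * Im K \<le> 0" if s: "s = 1 \<or> s = -1" for s :: real
  proof (rule ccontr)
    assume "\<not> ?thesis"
    then have pos: "0 < s * Im K" by simp
    \<comment> \<open>For this \<open>e\<close> and \<open>d = - e - s * \<i>\<close>, the real part of \<open>K * d\<close> is 0 although \<open>d\<close> points into the disc.\<close>
    define e where "e = s * Im K / Re K"
    have "Re (K * Complex (-e) (-s)) \<le> -e" using dir[of "Complex (-e) (-s)"] pos ReK by (simp add: e_def)
    then have "s * Im K \<le> e * Re K - e" by (simp add: algebra_simps)
    moreover have "e * Re K = s * Im K" "0 < e" using ReK pos by (auto simp: e_def)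
    ultimately show False by simp
  qed
  have "Im K = 0" using ImK[of 1] ImK[of "-1"] by simp
  then have "K = of_real (Re K)" by (simp add: complex_eq_iff)
  then show ?thesis
    by (intro that[OF ReK]) (use \<omega>nz in \<open>simp add: K_def field_simps\<close>)
qed

text \<open>
The form in which Jack's lemma proves that a function maps the disc into itself: at a point of
smallest modulus where \<open>\<bar>\<omega>\<bar>\<close> reaches 1, Jack's lemma supplies the multiplier \<open>k\<close>, so it is enough
to refute this one configuration. The differential equation that \<open>\<omega>\<close> satisfies usually does that.
\<close>

lemma Jack_principle:
  fixes \<omega> :: "complex \<Rightarrow> complex"
  assumes hol: "\<omega> holomorphic_on ball 0 1" and \<omega>0: "\<omega> 0 = 0"
    and no: "\<And>z k. cmod z < 1 \<Longrightarrow> cmod (\<omega> z) = 1 \<Longrightarrow> 1 \<le> k \<Longrightarrow>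
               z * deriv \<omega> z = of_real k * \<omega> z \<Longrightarrow> False"
    and z: "cmod z < 1"
  shows "cmod (\<omega> z) < 1"
proof (rule ccontr)
  assume "\<not> ?thesis"
  define S where "S = {y \<in> cball 0 (cmod z). 1 \<le> cmod (\<omega> y)}"
  have cont: "continuous_on (cball 0 (cmod z)) \<omega>"
    by (rule continuous_on_subset[OF holomorphic_on_imp_continuous_on[OF hol]]) (use z in auto)
  have "S = {y \<in> cball 0 (cmod z). cmod (\<omega> y) \<in> {1..}}" by (auto simp: S_def)
  also have "closed \<dots>"
    using continuous_closed_preimage[OF continuous_on_norm[OF cont], of "{1..}"]
    by (simp add: vimage_def Int_def)
  finally have "compact S"
    unfolding compact_eq_bounded_closed
    using bounded_subset[OF bounded_cball, of S 0 "cmod z"] by (simp add: S_def subset_iff)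
  have "z \<in> S" using \<open>\<not> _\<close> by (simp add: S_def)
  obtain z0 where z0: "z0 \<in> S" and z0min: "\<And>y. y \<in> S \<Longrightarrow> cmod z0 \<le> cmod y"
    using continuous_attains_inf[OF \<open>compact S\<close>, of cmod] \<open>z \<in> S\<close> continuous_on_norm_id by blast
  have z0z: "cmod z0 \<le> cmod z" and z01: "1 \<le> cmod (\<omega> z0)" using z0 by (auto simp: S_def)
  have z0nz: "z0 \<noteq> 0" using z01 \<omega>0 by auto
  have inside: "cmod (\<omega> y) < 1" if "cmod y < cmod z0" for y
    using z0min[of y] that z0z by (force simp: S_def)
  have "isCont \<omega> z0" using holomorphic_on_imp_continuous_on[OF hol] z z0z
    by (intro continuous_on_interior[of "ball 0 1"]) auto
  then have "((\<lambda>t. cmod (\<omega> (of_real t * z0))) \<longlongrightarrow> cmod (\<omega> z0)) (at_left 1)"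
    by (intro tendsto_norm isCont_tendsto_compose[of z0 \<omega>]) 
      (auto intro!: tendsto_eq_intros)
  moreover have "eventually (\<lambda>t. cmod (\<omega> (of_real t * z0)) \<le> 1) (at_left (1::real))"
    unfolding eventually_at_left_field
    by (rule exI[of _ 0]) (use z0nz in \<open>auto intro!: less_imp_le inside simp: norm_mult\<close>)
  ultimately have "cmod (\<omega> z0) \<le> 1"
    by (intro tendsto_upperbound) auto
  with z01 have "cmod (\<omega> z0) = 1" by simp
  moreover from this obtain k where "1 \<le> k" "z0 * deriv \<omega> z0 = of_real k * \<omega> z0"
    using Jack_derivative[OF hol \<omega>0 _ _ inside] z z0z by (metis order_le_less_trans)
  ultimately show False using no[of z0 k] z z0z by simp
qed

text \<open>
Unless \<open>\<phi>\<close> is a unimodular constant, it maps into the open disc; the disc automorphism that moves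
\<open>\<phi> 0\<close> to 0 turns it into a function to which the Schwarz lemma applies. The value \<open>1 - \<bar>\<phi> 0\<bar>\<^sup>2\<close>
is the inverse of the derivative of that automorphism at \<open>\<phi> 0\<close>.
\<close>

lemma Schwarz_Pick_at_0:
  assumes hol: "\<phi> holomorphic_on ball 0 1" and le: "\<And>z. cmod z < 1 \<Longrightarrow> cmod (\<phi> z) \<le> 1"
  shows "cmod (deriv \<phi> 0) \<le> 1 - (cmod (\<phi> 0))\<^sup>2"
proof (cases "\<exists>z. cmod z < 1 \<and> cmod (\<phi> z) = 1")
  case True
  then obtain z where z: "cmod z < 1" "cmod (\<phi> z) = 1" by blast
  have "\<phi> constant_on ball 0 1"
    by (rule maximum_modulus_principle[OF hol, of "ball 0 1" z]) (use z le in auto)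
  then obtain c where c: "\<And>x. cmod x < 1 \<Longrightarrow> \<phi> x = c" by (auto simp: constant_on_def)
  have "deriv \<phi> 0 = deriv (\<lambda>_. c) 0"
    by (intro deriv_cong_ev refl) (use c in \<open>auto intro!: eventually_nhds_in_open[of "ball 0 1", THEN eventually_mono]\<close>)
  then show ?thesis using c[of 0] c[of z] z by simp
next
  case False
  then have lt: "cmod (\<phi> z) < 1" if "cmod z < 1" for z using le that by fastforce
  define a where "a = \<phi> 0"
  have a: "cmod a < 1" using lt by (simp add: a_def)
  define u where "u z = Moebius_function 0 a (\<phi> z)" for z
  have "u holomorphic_on ball 0 1"
    unfolding u_def
    by (rule holomorphic_on_compose_gen[OF hol Moebius_function_holomorphic[OF a], unfolded o_def])
      (use lt in auto)
  from Schwarz_Lemma(2)[OF this, of 0] have du: "cmod (deriv u 0) \<le> 1"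
    using lt a by (auto simp: u_def a_def Moebius_function_norm_lt_1 Moebius_function_eq_zero)
  have pos: "0 < 1 - (cmod a)\<^sup>2" using a by (simp add: abs_square_less_1)
  have denom: "1 - cnj a * a = of_real (1 - (cmod a)\<^sup>2)"
    using complex_norm_square[of a] by (simp add: mult.commute)
  then have nz: "1 - cnj a * a \<noteq> 0" using pos by (metis less_irrefl of_real_eq_0_iff)
  have "(\<phi> has_field_derivative deriv \<phi> 0) (at 0)" using holomorphic_derivI[OF hol, of 0] by simp
  then have "(u has_field_derivative deriv \<phi> 0 / (1 - cnj a * a)) (at 0)"
    unfolding u_def Moebius_function_simple
    using nz by (auto intro!: derivative_eq_intros simp: a_def)
  then have "deriv u 0 = deriv \<phi> 0 / (1 - cnj a * a)" by (rule DERIV_imp_deriv)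
  then have "cmod (deriv \<phi> 0) / (1 - (cmod a)\<^sup>2) \<le> 1"
    using du pos unfolding denom by (simp add: norm_divide del: of_real_diff of_real_power)
  then show ?thesis using pos by (simp add: a_def field_simps)
qed

text \<open>
Working with \<open>\<phi>\<close> instead of \<open>\<omega>\<close> makes the first two Taylor coefficients of \<open>\<omega>\<close> the value and the
derivative of \<open>\<phi>\<close> at 0, which is the form that the Schwarz--Pick inequality constrains.
\<close>

lemma Schwarz_factor:
  assumes hol: "\<omega> holomorphic_on ball 0 1" and \<omega>0: "\<omega> 0 = 0" 
    and lt: "\<And>z. cmod z < 1 \<Longrightarrow> cmod (\<omega> z) < 1"
  obtains \<phi> where "\<phi> holomorphic_on ball 0 1" "\<And>z. cmod z < 1 \<Longrightarrow> \<omega> z = z * \<phi> z"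
    "\<And>z. cmod z < 1 \<Longrightarrow> cmod (\<phi> z) \<le> 1"
proof -
  obtain \<phi> where \<phi>: "\<phi> holomorphic_on ball 0 1" "\<And>z. cmod z < 1 \<Longrightarrow> \<omega> z = z * \<phi> z"
    "deriv \<omega> 0 = \<phi> 0"
    using Schwarz3[OF hol \<omega>0] by metis
  moreover have "cmod (\<phi> z) \<le> 1" if z: "cmod z < 1" for z
  proof (cases "z = 0")
    case True
    then show ?thesis using Schwarz_Lemma(2)[OF hol \<omega>0 lt z] \<phi>(3) by simp
  next
    case False
    then show ?thesis
      using Schwarz_Lemma(1)[OF hol \<omega>0 lt z] \<phi>(2)[OF z] by (simp add: norm_mult)
  qed
  ultimately show ?thesis using that by blast
qed

section \<open>Convex functions take small values exactly once\<close>

text \<open>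
Inversion maps the unit disc centred at 1 onto the half plane \<open>Re > 1/2\<close>.
\<close>

lemma Re_inverse_circle:
  fixes a :: complex
  assumes a: "a \<noteq> 0"
  shows "cmod (a - 1) = 1 \<Longrightarrow> Re (inverse a) = 1 / 2"
    and "cmod (a - 1) < 1 \<Longrightarrow> 1 / 2 < Re (inverse a)"
proof -
  have sq: "(cmod (a - 1))\<^sup>2 = (cmod a)\<^sup>2 - 2 * Re a + 1"
    unfolding cmod_power2 by (simp add: power2_eq_square algebra_simps)
  have pos: "0 < (cmod a)\<^sup>2" using a by simp
  have inv: "Re (inverse a) = Re a / (cmod a)\<^sup>2" by (simp add: cmod_power2)
  show "Re (inverse a) = 1 / 2" if "cmod (a - 1) = 1"
  proof -
    have "(cmod a)\<^sup>2 = 2 * Re a" using sq that by simp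
    then show ?thesis unfolding inv using pos by (simp add: field_simps)
  qed
  show "1 / 2 < Re (inverse a)" if "cmod (a - 1) < 1"
  proof -
    have "(cmod (a - 1))\<^sup>2 < 1" using that by (simp add: abs_square_less_1)
    then have "(cmod a)\<^sup>2 < 2 * Re a" using sq by simp
    then show ?thesis unfolding inv using pos by (simp add: field_simps)
  qed
qed

text \<open>
The analytic content of convexity, with \<open>p = f'' / f'\<close>. Writing this as a linear differential
equation avoids the division and forces \<open>f'\<close> to have no zeros.
\<close>

locale convex_ode =
  fixes f p :: "complex \<Rightarrow> complex"
  assumes f_hol: "f holomorphic_on udisc" and p_hol: "p holomorphic_on udisc"
    and f_0: "f 0 = 0" and deriv_f_0: "deriv f 0 = 1"
    and ode: "\<And>z. z \<in> udisc \<Longrightarrow> deriv (deriv f) z = p z * deriv f z"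
    and Re_pos: "\<And>z. z \<in> udisc \<Longrightarrow> 0 < Re (1 + z * p z)"
begin

lemma df: "z \<in> udisc \<Longrightarrow> (f has_field_derivative deriv f z) (at z)"
  using holomorphic_derivI[OF f_hol] by simp

lemma deriv_f_hol: "deriv f holomorphic_on udisc"
  using f_hol by (rule holomorphic_deriv) simp

lemma ddf: "z \<in> udisc \<Longrightarrow> (deriv f has_field_derivative p z * deriv f z) (at z)"
  using holomorphic_derivI[OF deriv_f_hol] ode by simp

text \<open>
With a primitive \<open>P\<close> of \<open>p\<close>, the product \<open>f' * exp (- P)\<close> has derivative 0, so it is a nonzero constant.
\<close>

lemma deriv_f_nz:
  assumes z: "z \<in> udisc"
  shows "deriv f z \<noteq> 0"
proof -
  obtain P where P: "\<And>x. x \<in> udisc \<Longrightarrow> (P has_field_derivative p x) (at x)"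
    using holomorphic_convex_primitive'[OF _ _ p_hol]
    by (metis at_within_open convex_ball open_ball)
  have "((\<lambda>x. deriv f x * exp (- P x)) has_field_derivative 0) (at x)" if x: "x \<in> udisc" for x
    using P[OF x] ddf[OF x] by (auto intro!: derivative_eq_intros)
  then have "\<exists>c. \<forall>x \<in> udisc. deriv f x * exp (- P x) = c"
    by (intro has_field_derivative_zero_constant) (auto intro: has_field_derivative_at_within)
  then obtain c where c: "\<And>x. x \<in> udisc \<Longrightarrow> deriv f x * exp (- P x) = c" by blast
  have "c \<noteq> 0" using c[of 0] deriv_f_0 by auto
  then show ?thesis using c[OF z] by auto
qed

text \<open>
The three functions below are \<open>f z / z\<close>, \<open>f z / (z * f' z)\<close> and \<open>z / f z\<close>, extended to 0 by their limits.
The reciprocals of the usual quotients \<open>z f'/f\<close> and \<open>f/z\<close> are used because \<open>f'\<close> is already known to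
have no zeros, while \<open>f\<close> is not: that \<open>f\<close> vanishes only at 0 is a consequence of the bound on \<open>h\<close>.
\<close>

definition quot :: "complex \<Rightarrow> complex" where
  "quot z = (if z = 0 then 1 else f z / z)"

definition h :: "complex \<Rightarrow> complex" where
  "h z = quot z / deriv f z"

definition g :: "complex \<Rightarrow> complex" where
  "g z = inverse (quot z)"

lemma quot_hol: "quot holomorphic_on udisc"
  by (rule pole_theorem_open_0[OF f_hol, of 0]) (auto simp: quot_def f_0 deriv_f_0)

lemma z_quot: "z * quot z = f z"
  by (simp add: quot_def f_0)

lemma h_hol: "h holomorphic_on udisc"
  unfolding h_def using deriv_f_nz by (intro holomorphic_intros quot_hol deriv_f_hol) auto

lemma h_0: "h 0 = 1"
  by (simp add: h_def quot_def deriv_f_0)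

lemma f_eq: "z \<in> udisc \<Longrightarrow> f z = z * h z * deriv f z"
  using deriv_f_nz by (simp add: h_def z_quot)

text \<open>
Differentiate \<open>f = z * h * f'\<close>, replace \<open>f''\<close> by \<open>p * f'\<close> and cancel \<open>f'\<close>.
\<close>

lemma h_ode:
  assumes z: "z \<in> udisc"
  shows "z * deriv h z + h z * (1 + z * p z) = 1"
proof -
  have dh: "(h has_field_derivative deriv h z) (at z)"
    using holomorphic_derivI[OF h_hol] z by simp
  have "((\<lambda>x. x * h x * deriv f x) has_field_derivative
          (h z + z * deriv h z) * deriv f z + z * h z * (p z * deriv f z)) (at z)"
    using dh ddf[OF z] by (auto intro!: derivative_eq_intros simp: algebra_simps)
  moreover have "((\<lambda>x. x * h x * deriv f x) has_field_derivative deriv f z) (at z)"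
    by (rule has_field_derivative_transform_within_open[OF df[OF z], of udisc])
      (use z f_eq in auto)
  ultimately have "(h z + z * deriv h z) * deriv f z + z * h z * (p z * deriv f z) = deriv f z"
    by (rule DERIV_unique)
  then have "(z * deriv h z + h z * (1 + z * p z)) * deriv f z = 1 * deriv f z"
    by (simp add: algebra_simps)
  then show ?thesis using deriv_f_nz[OF z] by simp
qed

text \<open>
Marx--Strohhaecker: a convex function is starlike of order 1/2, that is, \<open>Re (z f'/f) > 1/2\<close>. If
\<open>1 - h\<close> first reached the unit circle at \<open>z\<close>, Jack's lemma and the equation for \<open>h\<close> would give
\<open>1 + z p = 1/h + k (1/h - 1)\<close> with \<open>Re (1/h) = 1/2\<close>, whose real part \<open>(1 - k) / 2\<close> is not positive.
\<close>

lemma h_near_1: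
  assumes "z \<in> udisc"
  shows "cmod (1 - h z) < 1"
proof (rule Jack_principle[of "\<lambda>z. 1 - h z"])
  show "(\<lambda>z. 1 - h z) holomorphic_on ball 0 1" by (intro holomorphic_intros h_hol)
  show "1 - h 0 = 0" by (simp add: h_0)
  show "cmod z < 1" using assms by simp
  fix z and k :: real
  assume z: "cmod z < 1" and on: "cmod (1 - h z) = 1" and k: "1 \<le> k"
    and eq: "z * deriv (\<lambda>z. 1 - h z) z = of_real k * (1 - h z)"
  have "(h has_field_derivative deriv h z) (at z)"
    using holomorphic_derivI[OF h_hol] z by simp
  then have "deriv (\<lambda>z. 1 - h z) z = - deriv h z"
    by (intro DERIV_imp_deriv) (auto intro!: derivative_eq_intros)
  with eq have eq1: "h z * (1 + z * p z) = 1 + of_real k * (1 - h z)"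
    using h_ode[of z] z by (simp add: algebra_simps)
  have nz: "h z \<noteq> 0"
  proof
    assume "h z = 0"
    then have "Re (1 + complex_of_real k) = 0" using eq1 by simp
    then show False using k by simp
  qed
  then have "1 + z * p z = inverse (h z) + of_real k * (inverse (h z) - 1)"
    using eq1 by (simp add: field_simps)
  then have "Re (1 + z * p z) = Re (inverse (h z) + of_real k * (inverse (h z) - 1))"
    by (rule arg_cong)
  also have "\<dots> = Re (inverse (h z)) + k * (Re (inverse (h z)) - 1)"
    by (simp del: inverse_complex.sel)
  also have "\<dots> = (1 - k) / 2"
    using Re_inverse_circle(1)[OF nz] on
    by (simp add: norm_minus_commute field_simps del: inverse_complex.sel)
  finally show False using Re_pos[of z] z k by simp
qed

lemma h_nz: "z \<in> udisc \<Longrightarrow> h z \<noteq> 0"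
  using h_near_1[of z] by auto

lemma quot_nz: "z \<in> udisc \<Longrightarrow> quot z \<noteq> 0"
  using h_nz[of z] by (auto simp: h_def)

lemma g_hol: "g holomorphic_on udisc"
  unfolding g_def using quot_nz by (intro holomorphic_intros quot_hol) auto

lemma g_0: "g 0 = 1"
  by (simp add: g_def quot_def)

lemma g_nz: "z \<in> udisc \<Longrightarrow> g z \<noteq> 0"
  using quot_nz by (simp add: g_def)

lemma g_f: "z \<in> udisc \<Longrightarrow> g z * f z = z"
  using quot_nz by (simp add: g_def flip: z_quot)

lemma g_ode:
  assumes z: "z \<in> udisc"
  shows "h z * (z * deriv g z) = g z * (h z - 1)"
proof -
  have dq: "(quot has_field_derivative deriv quot z) (at z)"
    using holomorphic_derivI[OF quot_hol] z by simp
  have "((\<lambda>x. x * quot x) has_field_derivative quot z + z * deriv quot z) (at z)"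
    using dq by (auto intro!: derivative_eq_intros)
  moreover have "((\<lambda>x. x * quot x) has_field_derivative deriv f z) (at z)"
    using df[OF z] by (simp add: z_quot)
  ultimately have f': "quot z + z * deriv quot z = deriv f z" by (rule DERIV_unique)
  have "deriv g z = - deriv quot z / (quot z)\<^sup>2"
    unfolding g_def using dq quot_nz[OF z]
    by (intro DERIV_imp_deriv) (auto intro!: derivative_eq_intros simp: power2_eq_square divide_simps)
  then have "h z * (z * deriv g z) = h z * (quot z - deriv f z) / (quot z)\<^sup>2"
    unfolding f'[symmetric] by simp
  also have "\<dots> = g z * (h z - 1)"
    using quot_nz[OF z] deriv_f_nz[OF z]
    by (simp add: h_def g_def field_simps power2_eq_square)
  finally show ?thesis .
qed

text \<open>
The second Marx--Strohhaecker inequality, \<open>Re (f/z) > 1/2\<close>, by the same method: at a first contact the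
equation for \<open>g\<close> reads \<open>k (1 - 1/g) = 1 - 1/h\<close>, where the left-hand side has real part
\<open>k/2 \<ge> 1/2\<close> and the right-hand side has real part below \<open>1/2\<close>.
\<close>

lemma g_near_1:
  assumes "z \<in> udisc"
  shows "cmod (g z - 1) < 1"
proof (rule Jack_principle[of "\<lambda>z. g z - 1"])
  show "(\<lambda>z. g z - 1) holomorphic_on ball 0 1" by (intro holomorphic_intros g_hol)
  show "g 0 - 1 = 0" by (simp add: g_0)
  show "cmod z < 1" using assms by simp
  fix z and k :: real
  assume z: "cmod z < 1" and on: "cmod (g z - 1) = 1" and k: "1 \<le> k"
    and eq: "z * deriv (\<lambda>z. g z - 1) z = of_real k * (g z - 1)"
  have zD: "z \<in> udisc" using z by simp
  have "(g has_field_derivative deriv g z) (at z)"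
    using holomorphic_derivI[OF g_hol] z by simp
  then have "deriv (\<lambda>z. g z - 1) z = deriv g z"
    by (intro DERIV_imp_deriv) (auto intro!: derivative_eq_intros)
  with eq have eq1: "h z * (of_real k * (g z - 1)) = g z * (h z - 1)"
    using g_ode[OF zD] by simp
  define a b where "a = inverse (g z)" and "b = inverse (h z)"
  have "of_real k * (1 - a) = 1 - b"
  proof -
    have "h z * (of_real k * (g z - 1)) * (a * b) = g z * (h z - 1) * (a * b)" using eq1 by simp
    then show ?thesis using g_nz[OF zD] h_nz[OF zD] by (simp add: a_def b_def field_simps)
  qed
  then have "Re (of_real k * (1 - a)) = Re (1 - b)" by simp
  then have "k * (1 - Re a) = 1 - Re b" by simp
  moreover have "Re a = 1 / 2"
    unfolding a_def by (rule Re_inverse_circle(1)[OF g_nz[OF zD] on])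
  moreover have "Re b > 1 / 2"
    unfolding b_def using Re_inverse_circle(2)[OF h_nz[OF zD]] h_near_1[OF zD]
    by (simp add: norm_minus_commute)
  ultimately show False using k by simp
qed

text \<open>
This turns inversion of \<open>f\<close> into a fixed point problem for the map \<open>z \<longmapsto> w * g z\<close>.
\<close>

lemma f_eq_iff:
  assumes z: "z \<in> udisc"
  shows "f z = w \<longleftrightarrow> w * g z = z"
  using g_f[OF z] g_nz[OF z] by (metis mult.commute mult_cancel_left)

text \<open>
Cauchy's estimate on a circle of radius \<open>1/3\<close>, which stays inside the unit disc because \<open>1/2 + 1/3 < 1\<close>.
\<close>

lemma deriv_g_bound:
  assumes z: "cmod z \<le> 1 / 2"
  shows "cmod (deriv g z) \<le> 3"
proof -
  have sub: "cball z (1/3) \<subseteq> udisc"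
  proof
    fix y assume "y \<in> cball z (1/3)"
    then have "cmod (y - z) \<le> 1/3" by (simp add: dist_norm norm_minus_commute)
    then have "cmod y \<le> 1/2 + 1/3" using z norm_triangle_sub[of y z] by simp
    then show "y \<in> udisc" by simp
  qed
  have "cmod ((deriv ^^ 1) (\<lambda>z. g z - 1) z) \<le> fact 1 * 1 / (1/3) ^ 1"
  proof (rule Cauchy_inequality)
    have hol: "(\<lambda>z. g z - 1) holomorphic_on cball z (1/3)"
      using sub by (intro holomorphic_intros holomorphic_on_subset[OF g_hol])
    then show "(\<lambda>z. g z - 1) holomorphic_on ball z (1/3)"
      by (rule holomorphic_on_subset) auto
    show "continuous_on (cball z (1/3)) (\<lambda>z. g z - 1)"
      using hol by (rule holomorphic_on_imp_continuous_on)
    fix x assume "cmod (z - x) = 1/3"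
    then have "x \<in> cball z (1/3)" by (simp add: dist_norm)
    then have "x \<in> udisc" using sub by blast
    then show "cmod (g x - 1) \<le> 1" using g_near_1 by (simp add: less_imp_le)
  qed simp
  moreover have "z \<in> udisc" using z by simp
  then have "(g has_field_derivative deriv g z) (at z)"
    using holomorphic_derivI[OF g_hol] by simp
  then have "deriv (\<lambda>z. g z - 1) z = deriv g z"
    by (intro DERIV_imp_deriv) (auto intro!: derivative_eq_intros)
  ultimately show ?thesis by simp
qed

text \<open>
Since \<open>\<bar>g\<bar> \<le> 2\<close> on the disc, \<open>z \<longmapsto> w * g z\<close> maps the whole disc into the closed disc of radius
\<open>1/2\<close>, where \<open>\<bar>g'\<bar> \<le> 3\<close> makes it a contraction with factor \<open>3/4\<close>. Banach's fixed point theorem then gives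
existence and uniqueness at once.
\<close>

lemma unique_preimage:
  assumes w: "cmod w < 1 / 4"
  shows "\<exists>!z. z \<in> udisc \<and> f z = w"
proof -
  let ?K = "cball 0 (1/2) :: complex set"
  have inK: "cmod (w * g z) \<le> 1 / 2" if "z \<in> udisc" for z
  proof -
    have "cmod (g z) \<le> 2" using g_near_1[OF that] norm_triangle_sub[of "g z" 1] by simp
    then have "cmod w * cmod (g z) \<le> 1 / 4 * 2" using w by (intro mult_mono) auto
    then show ?thesis by (simp add: norm_mult)
  qed
  have KD: "z \<in> udisc" if "z \<in> ?K" for z using that by simp
  have "\<exists>!z \<in> ?K. w * g z = z"
  proof (rule Banach_fix[of _ "3 / 4"])
    show "complete ?K" by (simp add: compact_imp_complete)
    show "(\<lambda>z. w * g z) ` ?K \<subseteq> ?K" using inK KD by auto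
    fix x y assume xy: "x \<in> ?K" "y \<in> ?K"
    have "cmod (g x - g y) \<le> 3 * cmod (x - y)"
    proof (rule field_differentiable_bound[of ?K g "deriv g"])
      show "(g has_field_derivative deriv g z) (at z within ?K)" if "z \<in> ?K" for z
        using holomorphic_derivI[OF g_hol _ KD[OF that]] by simp
    qed (use xy deriv_g_bound in auto)
    then have "cmod w * cmod (g x - g y) \<le> 1 / 4 * (3 * cmod (x - y))"
      using w by (intro mult_mono) auto
    then show "dist (w * g x) (w * g y) \<le> 3 / 4 * dist x y"
      by (simp add: dist_norm norm_mult flip: right_diff_distrib)
  qed auto
  then obtain z where z: "z \<in> ?K" "w * g z = z" and
    uniq: "\<And>y. y \<in> ?K \<Longrightarrow> w * g y = y \<Longrightarrow> y = z" by blast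
  show ?thesis
  proof (rule ex1I[of _ z])
    show "z \<in> udisc \<and> f z = w" using f_eq_iff[OF KD[OF z(1)]] KD[OF z(1)] z(2) by blast
    fix y assume y: "y \<in> udisc \<and> f y = w"
    then have "w * g y = y" using f_eq_iff by blast
    then show "y = z" using uniq[of y] inK[of y] y by simp
  qed
qed

definition v :: "complex \<Rightarrow> complex" where
  "v = the_inv_into udisc f"

lemma
  assumes "cmod w < 1 / 4"
  shows v_in: "v w \<in> udisc" and f_v: "f (v w) = w"
  using theI'[OF unique_preimage[OF assms]] by (auto simp: v_def the_inv_into_def)

lemma v_f:
  assumes "z \<in> udisc" "cmod (f z) < 1 / 4"
  shows "v (f z) = z"
  using unique_preimage[OF assms(2)] v_in[OF assms(2)] f_v[OF assms(2)] assms(1) by blast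

lemma v_eq: "cmod w < 1 / 4 \<Longrightarrow> v w = w * g (v w)"
  using f_eq_iff[OF v_in, of w w] f_v by simp

lemma v_0: "v 0 = 0"
  using v_f[of 0] f_0 by simp

text \<open>
The preimage \<open>S\<close> of the disc of radius \<open>1/4\<close> is open and \<open>f\<close> is injective on it, so the inverse
function theorem for injective holomorphic maps applies.
\<close>

lemma v_hol: "v holomorphic_on ball 0 (1/4)"
proof -
  define S where "S = udisc \<inter> f -` ball 0 (1/4)"
  have "open S"
    unfolding S_def
    by (intro continuous_open_preimage holomorphic_on_imp_continuous_on f_hol) auto
  moreover have inj: "inj_on f S"
    by (rule inj_on_inverseI[of _ v]) (use v_f in \<open>auto simp: S_def\<close>)
  moreover have "f holomorphic_on S"
    by (rule holomorphic_on_subset[OF f_hol]) (auto simp: S_def)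
  ultimately obtain u where u: "u holomorphic_on f ` S" "\<And>z. z \<in> S \<Longrightarrow> u (f z) = z"
    using holomorphic_has_inverse by metis
  have *: "v w \<in> S \<and> f (v w) = w" if "w \<in> ball 0 (1/4)" for w
    using v_in f_v that by (auto simp: S_def)
  have "u holomorphic_on ball 0 (1/4)"
    by (rule holomorphic_on_subset[OF u(1)]) (use * in force)
  then show ?thesis
    by (rule holomorphic_transform) (use * u(2) in metis)
qed

end

section \<open>The logarithmic inverse coefficients of a convex function\<close>

text \<open>
Differentiating \<open>exp (L - M) = 1\<close> shows that \<open>L - M\<close> is constant.
\<close>

lemma holomorphic_logarithm_unique:
  fixes L M :: "complex \<Rightarrow> complex"
  assumes L: "L holomorphic_on ball 0 r" and M: "M holomorphic_on ball 0 r"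
    and 0: "L 0 = M 0"
    and eq: "\<And>w. w \<in> ball 0 r - {0} \<Longrightarrow> exp (L w) = exp (M w)"
    and w: "w \<in> ball 0 r"
  shows "L w = M w"
proof -
  have one: "exp (L x - M x) = 1" if "x \<in> ball 0 r" for x
    using eq[of x] 0 that by (cases "x = 0") (auto simp: exp_diff)
  have "((\<lambda>x. L x - M x) has_field_derivative 0) (at x)" if x: "x \<in> ball 0 r" for x
  proof -
    have d: "((\<lambda>x. L x - M x) has_field_derivative deriv (\<lambda>x. L x - M x) x) (at x)"
      using x by (intro holomorphic_derivI[of _ "ball 0 r"] holomorphic_intros L M) auto
    then have "((\<lambda>x. exp (L x - M x)) has_field_derivative deriv (\<lambda>x. L x - M x) x) (at x)"
      using DERIV_fun_exp[OF d] one[OF x] by simp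
    moreover have "((\<lambda>x. exp (L x - M x)) has_field_derivative 0) (at x)"
      by (rule has_field_derivative_transform_within_open[of "\<lambda>_. 1" _ _ "ball 0 r"])
        (use x one in auto)
    ultimately show ?thesis using d DERIV_unique by metis
  qed
  then have "\<exists>c. \<forall>x \<in> ball 0 r. L x - M x = c"
    by (intro has_field_derivative_zero_constant) (auto intro: has_field_derivative_at_within)
  moreover have "0 \<in> ball (0::complex) r" using w by (auto intro: order.strict_trans1[OF norm_ge_zero])
  ultimately have "L w - M w = L 0 - M 0" using w by metis
  then show ?thesis using 0 by simp
qed

context convex_ode
begin

text \<open>
As \<open>v w / w = g (v w)\<close> and \<open>g\<close> takes values in the right half plane, the principal
logarithm is the required branch.
\<close>

definition ell :: "complex \<Rightarrow> complex" where
  "ell w = Ln (g (v w))"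

lemma ell_hol: "ell holomorphic_on ball 0 (1/4)"
  unfolding ell_def
proof (rule holomorphic_on_Ln')
  show "(\<lambda>w. g (v w)) holomorphic_on ball 0 (1/4)"
    by (rule holomorphic_on_compose_gen[OF v_hol g_hol, unfolded o_def]) (use v_in in auto)
  fix w :: complex assume "w \<in> ball 0 (1/4)"
  then have "cmod (g (v w) - 1) < 1" using g_near_1 v_in by simp
  then have "\<bar>Re (g (v w) - 1)\<bar> < 1" using abs_Re_le_cmod order.strict_trans1 by blast
  then show "g (v w) \<notin> \<real>\<^sub>\<le>\<^sub>0" by (auto simp: complex_nonpos_Reals_iff)
qed

lemma ell_0: "ell 0 = 0"
  by (simp add: ell_def v_0 g_0)

lemma exp_ell: "cmod w < 1 / 4 \<Longrightarrow> exp (ell w) = g (v w)"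
  using g_nz[OF v_in] by (simp add: ell_def)

lemma v_exp_ell: "cmod w < 1 / 4 \<Longrightarrow> v w = w * exp (ell w)"
  using exp_ell v_eq by simp

lemma log_inverse_eq:
  assumes w: "w \<in> ball 0 (1/4)"
  shows "log_inverse f w = ell w"
proof -
  let ?P = "\<lambda>L. L holomorphic_on ball 0 (1/4) \<and> L 0 = 0 \<and>
        (\<forall>w \<in> ball 0 (1/4) - {0}. exp (L w) = the_inv_into udisc f w / w)"
  have ell: "exp (ell x) = the_inv_into udisc f x / x" if "x \<in> ball 0 (1/4) - {0}" for x
    using v_exp_ell[of x] that by (simp add: v_def)
  then have "?P ell" using ell_hol ell_0 by blast
  then have "?P (log_inverse f)" unfolding log_inverse_def by (rule someI[of ?P])
  then show ?thesis
    using ell ell_0 by (intro holomorphic_logarithm_unique[OF _ ell_hol _ _ w]) auto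
qed

lemma ell_fps: "ell has_fps_expansion fps_expansion ell 0"
  by (rule has_fps_expansion_fps_expansion[OF _ _ ell_hol]) auto

text \<open>
Power series expansions at 0 are unique, so the definite description picks the halved Taylor coefficients.
\<close>

lemma log_inv_coeff_eq: "log_inv_coeff f n = fps_nth (fps_expansion ell 0) n / 2"
proof -
  have "log_inv_coeff f = (\<lambda>n. fps_nth (fps_expansion ell 0) n / 2)"
    unfolding log_inv_coeff_def
  proof (rule the_equality, safe)
    show "fps_nth (fps_expansion ell 0) 0 / 2 = 0"
      by (simp add: fps_expansion_def ell_0)
    fix w :: complex assume w: "w \<in> ball 0 (1/4)"
    have "(\<lambda>n. fps_nth (fps_expansion ell 0) n * w ^ n) sums ell w"
    proof (rule has_fps_expansion_imp_sums_complex[OF ell_fps])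
      show "ell holomorphic_on eball 0 (ereal (1/4))"
        using ell_hol by (simp add: eball_def ball_def)
      show "ereal (cmod w) < ereal (1/4)" using w by simp
    qed
    then show "(\<lambda>n. 2 * (fps_nth (fps_expansion ell 0) n / 2) * w ^ n) sums log_inverse f w"
      using log_inverse_eq[OF w] by simp
  next
    fix G :: "nat \<Rightarrow> complex"
    assume G: "\<forall>w \<in> ball 0 (1/4). (\<lambda>n. 2 * G n * w ^ n) sums log_inverse f w"
    have "ell has_fps_expansion Abs_fps (\<lambda>n. 2 * G n)"
    proof (rule has_fps_expansionI)
      have "eventually (\<lambda>w. w \<in> ball (0::complex) (1/4)) (nhds 0)"
        by (rule eventually_nhds_in_open) auto
      then show "eventually (\<lambda>w. (\<lambda>n. fps_nth (Abs_fps (\<lambda>n. 2 * G n)) n * w ^ n) sums ell w) (nhds 0)"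
        by eventually_elim (use G log_inverse_eq in auto)
    qed
    then have "fps_expansion ell 0 = Abs_fps (\<lambda>n. 2 * G n)"
      using ell_fps by (intro fps_expansion_unique_complex)
    then show "G = (\<lambda>n. fps_nth (fps_expansion ell 0) n / 2)" by simp
  qed
  then show ?thesis by simp
qed

text \<open>
Logarithmic differentiation of \<open>v w / w\<close>: since \<open>v' w = 1 / f' (v w)\<close>, the quotient \<open>w * v' w / v w\<close>
is \<open>f / (z f')\<close> evaluated at \<open>z = v w\<close>.
\<close>

lemma ell_ode:
  assumes w: "w \<in> ball 0 (1/4)"
  shows "w * deriv ell w = h (v w) - 1"
proof (cases "w = 0")
  case True
  then show ?thesis by (simp add: v_0 h_0)
next
  case False
  have dl: "(ell has_field_derivative deriv ell w) (at w)"
    using holomorphic_derivI[OF ell_hol _ w] by simp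
  have vw: "v w \<in> udisc" using v_in w by simp
  let ?d = "exp (ell w) * (1 + w * deriv ell w)"
  have "((\<lambda>x. x * exp (ell x)) has_field_derivative ?d) (at w)"
    using dl by (auto intro!: derivative_eq_intros simp: algebra_simps)
  then have dv: "(v has_field_derivative ?d) (at w)"
    by (rule has_field_derivative_transform_within_open[of _ _ _ "ball 0 (1/4)"])
      (use w v_exp_ell in auto)
  have "((\<lambda>x. f (v x)) has_field_derivative deriv f (v w) * ?d) (at w)"
    by (rule DERIV_chain2[OF df[OF vw] dv])
  moreover have "((\<lambda>x. f (v x)) has_field_derivative 1) (at w)"
    by (rule has_field_derivative_transform_within_open[of "\<lambda>x. x" _ _ "ball 0 (1/4)"])
      (use w f_v in auto)
  ultimately have one: "deriv f (v w) * ?d = 1" by (rule DERIV_unique)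
  have "h (v w) * (v w * deriv f (v w)) = w"
    using f_eq[OF vw] f_v w by (simp add: mult_ac)
  then have "h (v w) * (v w * deriv f (v w)) * ?d = w * ?d" by simp
  then have "h (v w) * v w * (deriv f (v w) * ?d) = w * ?d" by (simp only: mult_ac)
  then have "h (v w) * (w * exp (ell w)) = w * ?d" using one v_exp_ell[of w] w by simp
  then have "(w * exp (ell w)) * h (v w) = (w * exp (ell w)) * (1 + w * deriv ell w)"
    by (simp only: mult_ac)
  then have "h (v w) = 1 + w * deriv ell w" using False by simp
  then show ?thesis by simp
qed

text \<open>
Comparison of coefficients in \<open>z h' + h (1 + z p) = 1\<close>, in \<open>h \<circ> v = 1 + w * ell'\<close> and in
\<open>v = w * exp ell\<close>. The last one shows that the second coefficient of \<open>v\<close> equals the first one of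
\<open>ell\<close>.
\<close>

lemma log_inv_coeff_1_2:
  shows "log_inv_coeff f 1 = - (p 0) / 4"
    and "log_inv_coeff f 2 = 5 / 48 * (p 0)\<^sup>2 - deriv p 0 / 12"
proof -
  define H P L V where defs: "H = fps_expansion h 0" "P = fps_expansion p 0"
    "L = fps_expansion ell 0" "V = fps_expansion v 0"
  have H: "h has_fps_expansion H" and P: "p has_fps_expansion P" and V: "v has_fps_expansion V"
    and L: "ell has_fps_expansion L"
    unfolding defs using h_hol p_hol v_hol ell_hol
    by (auto intro!: has_fps_expansion_fps_expansion[of "ball 0 1"]
        has_fps_expansion_fps_expansion[of "ball 0 (1/4)"])
  have ev1: "eventually (\<lambda>z. z \<in> udisc) (nhds 0)"
    and ev2: "eventually (\<lambda>z. z \<in> ball (0::complex) (1/4)) (nhds 0)"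
    by (rule eventually_nhds_in_open; simp)+
  have V0: "fps_nth V 0 = 0" and H0: "fps_nth H 0 = 1" and L0: "fps_nth L 0 = 0"
    by (auto simp: defs fps_expansion_def v_0 h_0 ell_0)
  have "(\<lambda>z. z * deriv h z + h z * (1 + z * p z)) has_fps_expansion
      fps_X * fps_deriv H + H * (1 + fps_X * P)"
    by (intro fps_expansion_intros H P)
  then have "(\<lambda>z. 1) has_fps_expansion fps_X * fps_deriv H + H * (1 + fps_X * P)"
    by (rule has_fps_expansion_cong[THEN iffD1, rotated 2])
      (use ev1 h_ode in \<open>auto elim!: eventually_mono\<close>)
  then have Heq: "fps_X * fps_deriv H + H * (1 + fps_X * P) = 1"
    using fps_expansion_unique_complex has_fps_expansion_1 by blast
  have "(h \<circ> v) has_fps_expansion (H oo V)"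
    by (rule has_fps_expansion_compose[OF H V V0])
  moreover have "(\<lambda>w. 1 + w * deriv ell w) has_fps_expansion 1 + fps_X * fps_deriv L"
    by (intro fps_expansion_intros L)
  then have "(h \<circ> v) has_fps_expansion 1 + fps_X * fps_deriv L"
    by (rule has_fps_expansion_cong[THEN iffD1, rotated 2])
      (use ev2 ell_ode in \<open>auto elim!: eventually_mono\<close>)
  ultimately have Leq: "H oo V = 1 + fps_X * fps_deriv L"
    by (rule fps_expansion_unique_complex)
  have "(exp \<circ> ell) has_fps_expansion (fps_exp 1 oo L)"
    by (rule has_fps_expansion_compose[OF has_fps_expansion_exp1 L L0])
  then have "(\<lambda>w. w * (exp \<circ> ell) w) has_fps_expansion fps_X * (fps_exp 1 oo L)"
    by (intro has_fps_expansion_mult has_fps_expansion_fps_X)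
  then have "v has_fps_expansion fps_X * (fps_exp 1 oo L)"
    by (rule has_fps_expansion_cong[THEN iffD1, rotated 2])
      (use ev2 v_exp_ell in \<open>auto elim!: eventually_mono\<close>)
  then have Veq: "V = fps_X * (fps_exp 1 oo L)"
    using V by (rule fps_expansion_unique_complex[rotated])
  have V1: "fps_nth V 1 = 1" and V2: "fps_nth V 2 = fps_nth L 1"
    unfolding Veq by (simp_all add: fps_compose_nth numeral_2_eq_2)
  have P0: "fps_nth P 0 = p 0" and P1: "fps_nth P 1 = deriv p 0"
    by (auto simp: defs fps_expansion_def)
  have H1: "fps_nth H 1 = - p 0 / 2"
    using arg_cong[OF Heq, of "\<lambda>F. fps_nth F 1"] H0 P0 
    by (simp add: fps_mult_nth field_simps eq_neg_iff_add_eq_0)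
  have H2: "3 * fps_nth H 2 = (p 0)\<^sup>2 / 2 - deriv p 0"
  proof -
    have "deriv p 0 + (p 0 * fps_nth H 1 + 3 * fps_nth H 2) = 0"
      using arg_cong[OF Heq, of "\<lambda>F. fps_nth F 2"] H0 P0 P1
      by (simp add: fps_mult_nth numeral_2_eq_2 algebra_simps)
    then have "3 * fps_nth H 2 = 0 - deriv p 0 - p 0 * fps_nth H 1"
      by (metis add_diff_cancel_left')
    then show ?thesis unfolding H1 by (simp add: power2_eq_square)
  qed
  have L1: "fps_nth L 1 = fps_nth H 1"
    using arg_cong[OF Leq, of "\<lambda>F. fps_nth F 1"] H0 V0 V1
    by (simp add: fps_compose_nth)
  have L2: "2 * fps_nth L 2 = fps_nth H 1 * fps_nth V 2 + fps_nth H 2"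
    using arg_cong[OF Leq, of "\<lambda>F. fps_nth F 2"] H0 V0 V1 
    by (simp add: fps_compose_nth numeral_2_eq_2 fps_mult_nth)
  show "log_inv_coeff f 1 = - (p 0) / 4"
    using L1 H1 unfolding log_inv_coeff_eq defs(3)[symmetric] by simp
  have "fps_nth L 2 = 5 / 24 * (p 0)\<^sup>2 - deriv p 0 / 6"
  proof -
    have "fps_nth H 2 = ((p 0)\<^sup>2 / 2 - deriv p 0) / 3" using H2 by (simp add: eq_divide_eq mult.commute)
    moreover have "fps_nth L 2 = (fps_nth H 1 * fps_nth H 1 + fps_nth H 2) / 2"
      using L2 unfolding V2 L1 by (simp add: eq_divide_eq mult.commute)
    ultimately have "fps_nth L 2 = (- p 0 / 2 * (- p 0 / 2) + ((p 0)\<^sup>2 / 2 - deriv p 0) / 3) / 2"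
      unfolding H1 by simp
    then show ?thesis by (simp add: power2_eq_square field_simps)
  qed
  then show "log_inv_coeff f 2 = 5 / 48 * (p 0)\<^sup>2 - deriv p 0 / 12"
    unfolding log_inv_coeff_eq defs(3)[symmetric] by simp
qed

end

section \<open>Janowski convex functions and Schwarz functions\<close>

lemma one_plus_nz:
  fixes B :: real and t :: complex
  assumes "\<bar>B\<bar> \<le> 1" "cmod t < 1"
  shows "1 + of_real B * t \<noteq> 0"
proof
  assume "1 + of_real B * t = 0"
  then have "cmod (of_real B * t) = 1" by (metis add_eq_0_iff norm_minus_cancel norm_one)
  moreover have "\<bar>B\<bar> * cmod t \<le> 1 * cmod t" using assms by (intro mult_right_mono) auto
  ultimately show False using assms by (simp add: norm_mult)
qed

text \<open>
Multiplying by the conjugate of the denominator leaves \<open>1 + (A + B) Re t + A B \<bar>t\<bar>\<^sup>2\<close>. As it is affine in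
\<open>Re t\<close>, its smallest value for \<open>\<bar>Re t\<bar> \<le> r = \<bar>t\<bar>\<close> occurs at an end point, where it factors as
\<open>(1 \<plusminus> A r) (1 \<plusminus> B r)\<close>.
\<close>

lemma Re_janowski_pos:
  fixes A B :: real and t :: complex
  assumes A: "\<bar>A\<bar> \<le> 1" and B: "\<bar>B\<bar> \<le> 1" and t: "cmod t < 1"
  shows "0 < Re ((1 + of_real A * t) / (1 + of_real B * t))"
proof -
  define r where "r = cmod t"
  have r: "0 \<le> r" "r < 1" using t by (auto simp: r_def)
  have Ar: "\<bar>A * r\<bar> < 1" "\<bar>B * r\<bar> < 1"
    using A B r mult_mono[of "\<bar>A\<bar>" 1 r r] mult_mono[of "\<bar>B\<bar>" 1 r r] by (auto simp: abs_mult)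
  have "0 < (1 + A * r) * (1 + B * r)" "0 < (1 - A * r) * (1 - B * r)"
    using Ar by (auto intro!: mult_pos_pos)
  moreover have "\<bar>(A + B) * Re t\<bar> \<le> \<bar>A + B\<bar> * r"
    unfolding abs_mult r_def by (intro mult_left_mono abs_Re_le_cmod) auto
  ultimately have "0 < 1 + (A + B) * Re t + A * B * r\<^sup>2"
    by (simp add: algebra_simps power2_eq_square abs_if split: if_splits)
  also have "\<dots> = Re ((1 + of_real A * t) * cnj (1 + of_real B * t))"
    unfolding r_def cmod_power2 by (simp add: algebra_simps power2_eq_square)
  finally have num: "0 < Re ((1 + of_real A * t) * cnj (1 + of_real B * t))" .
  have nz: "1 + of_real B * t \<noteq> 0" by (rule one_plus_nz[OF B t])
  have "Re ((1 + of_real A * t) / (1 + of_real B * t)) =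
    Re ((1 + of_real A * t) * cnj (1 + of_real B * t)) / (cmod (1 + of_real B * t))\<^sup>2"
    by (subst complex_div_cnj) (simp only: Re_divide_of_real of_real_power[symmetric])
  then show ?thesis using num nz by simp
qed

text \<open>
The value of \<open>f'' / f'\<close> when \<open>1 + z f'' / f' = (1 + A \<omega>) / (1 + B \<omega>)\<close> with \<open>\<omega> z = z * \<phi> z\<close>.
\<close>

definition janowski_preschwarzian :: "real \<Rightarrow> real \<Rightarrow> (complex \<Rightarrow> complex) \<Rightarrow> complex \<Rightarrow> complex" where
  "janowski_preschwarzian A B \<phi> z = of_real (A - B) * \<phi> z / (1 + of_real B * (z * \<phi> z))"

locale schwarz_datum =
  fixes A B :: real and \<phi> :: "complex \<Rightarrow> complex"
  assumes AB: "-1 \<le> B" "B < A" "A \<le> 1"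
    and \<phi>_hol: "\<phi> holomorphic_on udisc" and \<phi>_le: "\<And>z. cmod z < 1 \<Longrightarrow> cmod (\<phi> z) \<le> 1"
begin

abbreviation "p \<equiv> janowski_preschwarzian A B \<phi>"

lemma omega_less:
  assumes "cmod z < 1"
  shows "cmod (z * \<phi> z) < 1"
proof -
  have "cmod z * cmod (\<phi> z) \<le> cmod z * 1" using \<phi>_le[OF assms] by (intro mult_left_mono) auto
  then show ?thesis using assms by (simp add: norm_mult)
qed

lemma denom_nz: "cmod z < 1 \<Longrightarrow> 1 + of_real B * (z * \<phi> z) \<noteq> 0"
  using AB by (intro one_plus_nz omega_less) auto

lemma p_hol: "p holomorphic_on udisc"
  unfolding janowski_preschwarzian_def
  using denom_nz by (intro holomorphic_intros \<phi>_hol) auto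

lemma one_plus_p:
  assumes "cmod z < 1"
  shows "1 + z * p z = (1 + of_real A * (z * \<phi> z)) / (1 + of_real B * (z * \<phi> z))"
  using denom_nz[OF assms] by (simp add: janowski_preschwarzian_def field_simps)

lemma Re_one_plus_p: "cmod z < 1 \<Longrightarrow> 0 < Re (1 + z * p z)"
  using AB by (simp only: one_plus_p) (intro Re_janowski_pos omega_less; simp)

lemma p_0: "p 0 = of_real (A - B) * \<phi> 0"
  by (simp add: janowski_preschwarzian_def)

lemma deriv_p_0: "deriv p 0 = of_real (A - B) * (deriv \<phi> 0 - of_real B * (\<phi> 0)\<^sup>2)"
proof -
  have d: "(\<phi> has_field_derivative deriv \<phi> 0) (at 0)"
    using holomorphic_derivI[OF \<phi>_hol, of 0] by simp
  show ?thesis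
    unfolding janowski_preschwarzian_def
    by (rule DERIV_imp_deriv) (auto intro!: derivative_eq_intros d simp: power2_eq_square algebra_simps)
qed

text \<open>
The common factor \<open>(A - B) / 12\<close> reduces the theorem to comparing \<open>3 \<bar>c\<^sub>1\<bar>\<close> with
\<open>\<bar>c\<^sub>2 - (5 A - B) / 4 * c\<^sub>1\<^sup>2\<bar>\<close> for the Taylor coefficients \<open>c\<^sub>1 = \<phi> 0\<close>, \<open>c\<^sub>2 = \<phi>' 0\<close> of \<open>\<omega>\<close>.
\<close>

lemma log_inv_coeffs:
  assumes "convex_ode f p"
  shows "cmod (log_inv_coeff f 1) = (A - B) / 12 * (3 * cmod (\<phi> 0))"
    and "cmod (log_inv_coeff f 2) =
           (A - B) / 12 * cmod (deriv \<phi> 0 - of_real ((5 * A - B) / 4) * (\<phi> 0)\<^sup>2)"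
proof -
  note c = convex_ode.log_inv_coeff_1_2[OF assms]
  show "cmod (log_inv_coeff f 1) = (A - B) / 12 * (3 * cmod (\<phi> 0))"
    unfolding c p_0 using AB by (simp add: norm_mult norm_divide del: of_real_diff)
  have "log_inv_coeff f 2 =
      - (of_real ((A - B) / 12) * (deriv \<phi> 0 - of_real ((5 * A - B) / 4) * (\<phi> 0)\<^sup>2))"
    unfolding c p_0 deriv_p_0 by (simp add: field_simps power2_eq_square)
  then show "cmod (log_inv_coeff f 2) =
      (A - B) / 12 * cmod (deriv \<phi> 0 - of_real ((5 * A - B) / 4) * (\<phi> 0)\<^sup>2)"
    using AB by (simp only: norm_minus_cancel norm_mult norm_of_real) simp
qed

text \<open>
Every admissible \<open>\<phi>\<close> comes from a function of the class: integrate \<open>f'' / f' = p\<close> twice, first to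
\<open>f' = exp P\<close> with \<open>P 0 = 0\<close> and then to \<open>f\<close>.
\<close>

lemma janowski_convexI:
  obtains f where "f \<in> janowski_convex A B" "convex_ode f p"
proof -
  obtain P0 where P0: "\<And>x. x \<in> udisc \<Longrightarrow> (P0 has_field_derivative p x) (at x)"
    using holomorphic_convex_primitive'[OF _ _ p_hol]
    by (metis at_within_open convex_ball open_ball)
  define P where "P x = P0 x - P0 0" for x
  have P: "(P has_field_derivative p x) (at x)" if "x \<in> udisc" for x
    unfolding P_def using P0[OF that] by (auto intro!: derivative_eq_intros)
  have "P holomorphic_on udisc"
    using P by (subst holomorphic_on_open) blast+
  then have "(\<lambda>x. exp (P x)) holomorphic_on udisc" by (intro holomorphic_intros)
  then obtain F0 where F0: "\<And>x. x \<in> udisc \<Longrightarrow> (F0 has_field_derivative exp (P x)) (at x)"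
    using holomorphic_convex_primitive'[of udisc "\<lambda>x. exp (P x)"]
    by (metis at_within_open convex_ball open_ball)
  define f where "f x = F0 x - F0 0" for x
  have f: "(f has_field_derivative exp (P x)) (at x)" if "x \<in> udisc" for x
    unfolding f_def using F0[OF that] by (auto intro!: derivative_eq_intros)
  have df: "deriv f x = exp (P x)" if "x \<in> udisc" for x
    using f[OF that] by (rule DERIV_imp_deriv)
  have ddf: "deriv (deriv f) x = p x * deriv f x" if x: "x \<in> udisc" for x
  proof -
    have "((\<lambda>x. exp (P x)) has_field_derivative p x * exp (P x)) (at x)"
      using P[OF x] by (auto intro!: derivative_eq_intros)
    then have "(deriv f has_field_derivative p x * exp (P x)) (at x)"
      by (rule has_field_derivative_transform_within_open[of _ _ _ udisc]) (use x df in auto)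
    then show ?thesis using df[OF x] by (simp add: DERIV_imp_deriv)
  qed
  have f_hol: "f holomorphic_on udisc"
    using f by (subst holomorphic_on_open) blast+
  have f_0: "f 0 = 0" "deriv f 0 = 1" using df[of 0] by (auto simp: f_def P_def)
  have "convex_ode f p"
    by unfold_locales (use f_hol p_hol f_0 ddf Re_one_plus_p in auto)
  moreover have "f \<in> janowski_convex A B"
  proof -
    have quot: "1 + z * deriv (deriv f) z / deriv f z
        = (1 + of_real A * (z * \<phi> z)) / (1 + of_real B * (z * \<phi> z))" if "z \<in> udisc" for z
      using one_plus_p[of z] ddf[OF that] df[OF that] that by simp
    have "(\<lambda>z. (1 + of_real A * (z * \<phi> z)) / (1 + of_real B * (z * \<phi> z))) holomorphic_on udisc"
      using denom_nz by (intro holomorphic_intros \<phi>_hol) auto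
    then have "(\<lambda>z. 1 + z * deriv (deriv f) z / deriv f z) holomorphic_on udisc"
      by (rule holomorphic_transform) (simp add: quot)
    moreover have "(\<lambda>z. (1 + of_real A * z) / (1 + of_real B * z)) holomorphic_on udisc"
      using AB one_plus_nz[of B] by (intro holomorphic_intros) auto
    moreover have "(\<lambda>z. z * \<phi> z) holomorphic_on udisc" by (intro holomorphic_intros \<phi>_hol)
    moreover have "(\<lambda>z. z * \<phi> z) ` udisc \<subseteq> udisc" using omega_less by auto
    ultimately have "subordinate (\<lambda>z. 1 + z * deriv (deriv f) z / deriv f z)
        (\<lambda>z. (1 + of_real A * z) / (1 + of_real B * z))"
      unfolding subordinate_def using quot by (intro conjI exI[of _ "\<lambda>z. z * \<phi> z"]) auto
    then show ?thesis
      using f_hol f_0 by (simp add: janowski_convex_def normalized_class_def)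
  qed
  ultimately show ?thesis using that by blast
qed

end

text \<open>
Subordination yields \<open>f'' = p * f'\<close> only where \<open>f'\<close> does not vanish, in particular near 0. Both sides are
holomorphic on the whole disc, so the identity theorem extends the equation, also across possible
zeros of \<open>f'\<close>, where the quotient in the definition of the class has its default value.
\<close>

lemma janowski_convexD:
  assumes AB: "-1 \<le> B" "B < A" "A \<le> 1" and f: "f \<in> janowski_convex A B"
  obtains \<phi> where "schwarz_datum A B \<phi>" "convex_ode f (janowski_preschwarzian A B \<phi>)"
proof -
  have f_hol: "f holomorphic_on udisc" and f_0: "f 0 = 0" "deriv f 0 = 1"
    using f by (auto simp: janowski_convex_def normalized_class_def)
  obtain \<omega> where \<omega>: "\<omega> holomorphic_on udisc" "\<omega> ` udisc \<subseteq> udisc" "\<omega> 0 = 0"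
    and sub: "\<And>z. z \<in> udisc \<Longrightarrow> 1 + z * deriv (deriv f) z / deriv f z
                = (1 + of_real A * \<omega> z) / (1 + of_real B * \<omega> z)"
    using f by (auto simp: janowski_convex_def subordinate_def)
  have "cmod (\<omega> z) < 1" if "cmod z < 1" for z
    using \<omega>(2) that by (simp add: image_subset_iff)
  then obtain \<phi> where \<phi>: "\<phi> holomorphic_on udisc" "\<And>z. cmod z < 1 \<Longrightarrow> \<omega> z = z * \<phi> z"
    "\<And>z. cmod z < 1 \<Longrightarrow> cmod (\<phi> z) \<le> 1"
    using Schwarz_factor[OF \<omega>(1,3)] by metis
  interpret schwarz_datum A B \<phi>
    by unfold_locales (use AB \<phi> in auto)
  have df_hol: "deriv f holomorphic_on udisc" using f_hol by (rule holomorphic_deriv) simp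
  have ddf_hol: "deriv (deriv f) holomorphic_on udisc" using df_hol by (rule holomorphic_deriv) simp
  have "isCont (deriv f) 0"
    using holomorphic_on_imp_continuous_on[OF df_hol]
    by (intro continuous_on_interior[of udisc]) auto
  then have "eventually (\<lambda>z. deriv f z \<noteq> 0) (at 0)"
    using f_0 by (intro tendsto_imp_eventually_ne[of _ 1]) (auto simp: isCont_def)
  then obtain d where d: "0 < d" "\<And>z. z \<noteq> 0 \<Longrightarrow> cmod z < d \<Longrightarrow> deriv f z \<noteq> 0"
    by (auto simp: eventually_at dist_norm)
  define U where "U = ball (0::complex) (min d 1) - {0}"
  have ode: "deriv (deriv f) z = p z * deriv f z" if "z \<in> udisc" for z
  proof (rule analytic_continuation_open[of U udisc "deriv (deriv f)" "\<lambda>z. p z * deriv f z"])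
    show "open U" by (auto simp: U_def)
    have "complex_of_real (min d 1 / 2) \<in> U" using d(1) by (auto simp: U_def)
    then show "U \<noteq> {}" by blast
    show "U \<subseteq> udisc" by (auto simp: U_def)
    show "deriv (deriv f) holomorphic_on udisc" by (rule ddf_hol)
    show "(\<lambda>z. p z * deriv f z) holomorphic_on udisc" by (intro holomorphic_intros p_hol df_hol)
    fix x assume x: "x \<in> U"
    then have x1: "cmod x < 1" and nz: "x \<noteq> 0" "deriv f x \<noteq> 0" using d by (auto simp: U_def)
    have "1 + x * deriv (deriv f) x / deriv f x = 1 + x * p x"
      using sub[of x] \<phi>(2)[OF x1] one_plus_p[OF x1] x1 by simp
    then show "deriv (deriv f) x = p x * deriv f x" using nz by (simp add: field_simps)
  qed (use that in auto)
  have "convex_ode f p"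
    by unfold_locales (use f_hol p_hol f_0 ode Re_one_plus_p in auto)
  then show ?thesis using that schwarz_datum_axioms by blast
qed

section \<open>The extremal problem for the first two coefficients of a Schwarz function\<close>

text \<open>
The maximum of \<open>3 x - max 0 ((t + 4) / 4 * x\<^sup>2 - 1)\<close> over \<open>0 \<le> x \<le> 1\<close>, where \<open>x\<close> stands for
\<open>\<bar>c\<^sub>1\<bar>\<close> and \<open>t\<close> for \<open>\<bar>5 A - B\<bar>\<close>. The expression increases up to the kink \<open>x = 2 / sqrt (t + 4)\<close>; after it,
a downward parabola with vertex \<open>x = 6 / (t + 4)\<close> takes over. For \<open>t \<le> 2\<close> the vertex is not before
1 and the end point \<open>x = 1\<close> wins; for \<open>t \<ge> 5\<close> the vertex is not after the kink and the kink wins; in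
between the vertex wins.
\<close>

definition profile_bound :: "real \<Rightarrow> real" where
  "profile_bound t =
     (if t \<le> 2 then 3 - t / 4 else if t \<ge> 5 then 6 / sqrt (t + 4) else 1 + 9 / (t + 4))"

lemma profile_le_bound:
  fixes x t D :: real
  assumes x: "0 \<le> x" "x \<le> 1" and t: "0 \<le> t"
    and D: "0 \<le> D" "(t + 4) / 4 * x\<^sup>2 - 1 \<le> D"
  shows "3 * x - D \<le> profile_bound t"
proof -
  define s where "s = (t + 4) / 4"
  have s: "1 \<le> s" using t by (simp add: s_def)
  have t_s: "t = 4 * s - 4" by (simp add: s_def add_divide_distrib)
  have D: "s * x\<^sup>2 - 1 \<le> D" "0 \<le> D" using D by (auto simp: s_def)
  consider "t \<le> 2" | "2 < t" "t < 5" | "5 \<le> t" by linarith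
  then show ?thesis
  proof cases
    case 1
    then have "s * (1 + x) \<le> 3 / 2 * 2" using x s by (intro mult_mono) (auto simp: s_def)
    then have "s * (1 + x) * (1 - x) \<le> 3 * (1 - x)" using x by (intro mult_right_mono) auto
    then have "3 * x - (s * x\<^sup>2 - 1) \<le> 3 - t / 4"
      by (simp add: t_s diff_divide_distrib algebra_simps power2_eq_square)
    then show ?thesis using 1 D by (simp add: profile_bound_def)
  next
    case 2
    \<comment> \<open>Completing the square at the vertex \<open>x = 3 / (2 * s)\<close>.\<close>
    have "0 \<le> (2 * s * x - 3)\<^sup>2 / (4 * s)" using s by simp
    also have "\<dots> = s * x\<^sup>2 - 3 * x + 9 / (t + 4)"
      using s by (simp add: t_s field_simps power2_eq_square)
    finally show ?thesis using 2 D by (simp add: profile_bound_def)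
  next
    case 3
    \<comment> \<open>The kink is at \<open>x = 1 / a\<close>; the condition \<open>t \<ge> 5\<close> becomes \<open>a \<ge> 3 / 2\<close>.\<close>
    define a where "a = sqrt (t + 4) / 2"
    have aa: "a\<^sup>2 = s" using t by (simp add: a_def s_def power_divide)
    have a: "3 / 2 \<le> a"
      using 3 real_le_rsqrt[of 3 "t + 4"] by (simp add: a_def)
    have M: "profile_bound t = 3 / a" using 3 by (simp add: profile_bound_def a_def)
    show ?thesis
    proof (cases "a * x \<le> 1")
      case True
      then have "3 * x \<le> 3 / a" using a by (simp add: field_simps)
      then show ?thesis using D M by simp
    next
      case False
      then have "3 * (a * x - 1) \<le> 2 * a * (a * x - 1)" using a by (intro mult_right_mono) auto
      also have "\<dots> \<le> (a * x + 1) * a * (a * x - 1)"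
        using False a by (intro mult_right_mono) auto
      finally have "a * (3 * x - (a\<^sup>2 * x\<^sup>2 - 1)) \<le> 3"
        by (simp add: algebra_simps power2_eq_square)
      then have "3 * x - (a\<^sup>2 * x\<^sup>2 - 1) \<le> 3 / a" using a by (simp add: field_simps)
      then show ?thesis using D M aa by simp
    qed
  qed
qed

lemma profile_bound_attained:
  fixes t :: real
  assumes t: "0 \<le> t"
  obtains x where "0 \<le> x" "x \<le> 1" "3 * x - \<bar>(t + 4) / 4 * x\<^sup>2 - 1\<bar> = profile_bound t"
proof -
  consider "t \<le> 2" | "2 < t" "t < 5" | "5 \<le> t" by linarith
  then show ?thesis
  proof cases
    case 1
    then show ?thesis using t by (intro that[of 1]) (auto simp: profile_bound_def add_divide_distrib)
  next
    case 2
    have *: "3 * (6 / u) - \<bar>u / 4 * (6 / u)\<^sup>2 - 1\<bar> = 1 + 9 / u" if u: "0 < u" "u \<le> 9" for u :: real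
    proof -
      have "u / 4 * (6 / u)\<^sup>2 = 9 / u" by (simp add: power2_eq_square)
      moreover have "1 \<le> 9 / u" using u by simp
      ultimately show ?thesis by simp
    qed
    show ?thesis
      by (rule that[of "6 / (t + 4)"]) (use 2 *[of "t + 4"] in \<open>auto simp: profile_bound_def\<close>)
  next
    case 3
    have "3 \<le> sqrt (t + 4)" using 3 by (intro real_le_rsqrt) simp
    moreover have "(t + 4) / 4 * (2 / sqrt (t + 4))\<^sup>2 = 1"
      using t by (simp add: power_divide)
    ultimately show ?thesis
      using 3 by (intro that[of "2 / sqrt (t + 4)"]) (auto simp: profile_bound_def)
  qed
qed

text \<open>
By Schwarz--Pick \<open>\<bar>c\<^sub>2\<bar> \<le> 1 - \<bar>c\<^sub>1\<bar>\<^sup>2\<close>, so the triangle inequality bounds \<open>D\<close> from both sides in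
terms of \<open>x = \<bar>c\<^sub>1\<bar>\<close> alone. The first estimate then holds because \<open>\<bar>5 A - B\<bar> \<le> 6\<close> on the
admissible range of parameters.
\<close>

lemma (in schwarz_datum) functional_bounds:
  defines "D \<equiv> cmod (deriv \<phi> 0 - of_real ((5 * A - B) / 4) * (\<phi> 0)\<^sup>2)"
  shows "D - 3 * cmod (\<phi> 0) \<le> 1"
    and "3 * cmod (\<phi> 0) - D \<le> profile_bound \<bar>5 * A - B\<bar>"
proof -
  define x where "x = cmod (\<phi> 0)"
  define t where "t = \<bar>5 * A - B\<bar>"
  have x: "0 \<le> x" "x \<le> 1" using \<phi>_le[of 0] by (auto simp: x_def)
  have t: "0 \<le> t" "t \<le> 6" using AB by (auto simp: t_def)
  have d: "cmod (deriv \<phi> 0) \<le> 1 - x\<^sup>2"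
    unfolding x_def by (rule Schwarz_Pick_at_0[OF \<phi>_hol \<phi>_le])
  have q: "cmod (of_real ((5 * A - B) / 4) * (\<phi> 0)\<^sup>2) = t / 4 * x\<^sup>2"
    unfolding norm_mult norm_power norm_of_real by (simp add: t_def x_def)
  have "D \<le> cmod (deriv \<phi> 0) + t / 4 * x\<^sup>2"
    unfolding D_def q[symmetric] by (rule norm_triangle_ineq4)
  also have "\<dots> \<le> 1 + (t / 4 - 1) * x\<^sup>2" using d by (simp add: algebra_simps)
  also have "\<dots> \<le> 1 + 1 / 2 * x\<^sup>2" using t by (intro add_left_mono mult_right_mono) auto
  also have "\<dots> \<le> 1 + x"
    using x mult_left_mono[of x 1 x] by (simp add: power2_eq_square)
  finally show "D - 3 * cmod (\<phi> 0) \<le> 1" using x unfolding x_def by linarith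
  have "t / 4 * x\<^sup>2 - cmod (deriv \<phi> 0) \<le> D"
    unfolding D_def q[symmetric] by (subst norm_minus_commute) (rule norm_triangle_ineq2)
  then have "(t + 4) / 4 * x\<^sup>2 - 1 \<le> D" using d by (simp add: field_simps)
  then show "3 * cmod (\<phi> 0) - D \<le> profile_bound \<bar>5 * A - B\<bar>"
    using profile_le_bound[OF x t(1)] unfolding x_def t_def D_def by simp
qed

text \<open>
The functions for which Schwarz--Pick at 0 is an equality with real data; the sign \<open>\<sigma>\<close> is the sign of
the derivative at 0. For \<open>x = 1\<close> the function degenerates to the constant 1.
\<close>

definition blaschke :: "real \<Rightarrow> real \<Rightarrow> complex \<Rightarrow> complex" where
  "blaschke x \<sigma> z = (of_real x + of_real \<sigma> * z) / (1 + of_real (\<sigma> * x) * z)"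

lemma blaschke_datum:
  fixes A B x \<sigma> :: real
  assumes AB: "-1 \<le> B" "B < A" "A \<le> 1" and x: "0 \<le> x" "x \<le> 1" and \<sigma>: "\<bar>\<sigma>\<bar> = 1"
  shows "schwarz_datum A B (blaschke x \<sigma>)" and "blaschke x \<sigma> 0 = of_real x" and "deriv (blaschke x \<sigma>) 0 = of_real (\<sigma> * (1 - x\<^sup>2))"
proof -
  have \<sigma>2: "\<sigma>\<^sup>2 = 1" using \<sigma> by (simp add: abs_square_eq_1)
  have nz: "1 + of_real (\<sigma> * x) * z \<noteq> 0" if "cmod z < 1" for z
    using that \<sigma> x by (intro one_plus_nz) (auto simp: abs_mult)
  have "cmod (blaschke x \<sigma> z) \<le> 1" if z: "cmod z < 1" for z
  proof -
    \<comment> \<open>The usual identity for disc automorphisms, which shows that the denominator dominates.\<close>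
    have "(cmod (1 + of_real (\<sigma> * x) * z))\<^sup>2 - (cmod (of_real x + of_real \<sigma> * z))\<^sup>2
        = 1 - x\<^sup>2 + \<sigma>\<^sup>2 * (x\<^sup>2 - 1) * (cmod z)\<^sup>2"
      unfolding cmod_power2 by (simp add: power2_eq_square algebra_simps)
    also have "\<dots> = (1 - x\<^sup>2) * (1 - (cmod z)\<^sup>2)" by (simp add: \<sigma>2 algebra_simps)
    also have "0 \<le> \<dots>" using x z by (intro mult_nonneg_nonneg) (auto simp: abs_square_le_1)
    finally have "(cmod (of_real x + of_real \<sigma> * z))\<^sup>2 \<le> (cmod (1 + of_real (\<sigma> * x) * z))\<^sup>2"
      by (simp only: diff_ge_0_iff_ge)
    then have "cmod (of_real x + of_real \<sigma> * z) \<le> cmod (1 + of_real (\<sigma> * x) * z)"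
      by (rule power2_le_imp_le) simp
    then show ?thesis using nz[OF z] by (simp add: blaschke_def norm_divide divide_le_eq_1)
  qed
  moreover have "blaschke x \<sigma> holomorphic_on udisc"
    unfolding blaschke_def using nz by (intro holomorphic_intros) auto
  ultimately show "schwarz_datum A B (blaschke x \<sigma>)" using AB by unfold_locales auto
  show "blaschke x \<sigma> 0 = of_real x" by (simp add: blaschke_def)
  show "deriv (blaschke x \<sigma>) 0 = of_real (\<sigma> * (1 - x\<^sup>2))"
    unfolding blaschke_def
    by (rule DERIV_imp_deriv) (auto intro!: derivative_eq_intros simp: power2_eq_square algebra_simps)
qed

text \<open>
Giving \<open>c\<^sub>2\<close> the sign of \<open>5 A - B\<close> makes \<open>c\<^sub>2\<close> and \<open>(5 A - B) / 4 * c\<^sub>1\<^sup>2\<close> cancel as much as possible, so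
the lower bound \<open>(t + 4) / 4 * x\<^sup>2 - 1\<close> for \<open>D\<close> is attained whenever it is nonnegative; for \<open>x = 0\<close> the same
family gives \<open>D = 1\<close>, the extreme case of the other inequality.
\<close>

lemma janowski_extremal:
  fixes A B x :: real
  assumes AB: "-1 \<le> B" "B < A" "A \<le> 1" and x: "0 \<le> x" "x \<le> 1"
  obtains f where "f \<in> janowski_convex A B"
    "cmod (log_inv_coeff f 1) = (A - B) / 12 * (3 * x)"
    "cmod (log_inv_coeff f 2) = (A - B) / 12 * \<bar>(\<bar>5 * A - B\<bar> + 4) / 4 * x\<^sup>2 - 1\<bar>"
proof -
  define \<sigma> :: real where "\<sigma> = (if 5 * A - B < 0 then -1 else 1)"
  have \<sigma>: "\<bar>\<sigma>\<bar> = 1" by (simp add: \<sigma>_def)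
  define \<phi> where "\<phi> = blaschke x \<sigma>"
  note b = blaschke_datum[OF AB x \<sigma>, folded \<phi>_def]
  interpret schwarz_datum A B \<phi> by (rule b(1))
  obtain f where f: "f \<in> janowski_convex A B" "convex_ode f p" by (rule janowski_convexI)
  have "deriv \<phi> 0 - of_real ((5 * A - B) / 4) * (\<phi> 0)\<^sup>2 =
      of_real (- \<sigma> * ((\<bar>5 * A - B\<bar> + 4) / 4 * x\<^sup>2 - 1))"
    unfolding b(2,3) by (simp add: \<sigma>_def field_simps)
  then have "cmod (deriv \<phi> 0 - of_real ((5 * A - B) / 4) * (\<phi> 0)\<^sup>2) =
      \<bar>- \<sigma> * ((\<bar>5 * A - B\<bar> + 4) / 4 * x\<^sup>2 - 1)\<bar>"
    by (simp only: norm_of_real)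
  also have "\<dots> = \<bar>(\<bar>5 * A - B\<bar> + 4) / 4 * x\<^sup>2 - 1\<bar>"
    unfolding abs_mult abs_minus_cancel \<sigma> by simp
  finally show ?thesis
    using that[OF f(1)] log_inv_coeffs[OF f(2)] b(2) x by simp
qed

section \<open>Sharp bounds for the difference of the moduli\<close>

theorem theorem4p3:
  fixes A B :: real
  assumes "-1 \<le> B" and "B < A" and "A \<le> 1"
  defines "bound \<equiv>
     (if \<bar>5 * A - B\<bar> \<le> 2 then (A - B) / 4 * (1 - \<bar>5 * A - B\<bar> / 12)
      else if \<bar>5 * A - B\<bar> \<ge> 5 then (A - B) / (2 * sqrt (\<bar>5 * A - B\<bar> + 4))
      else (A - B) / 12 * (1 + 9 / (\<bar>5 * A - B\<bar> + 4)))"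
  shows "(\<forall>f \<in> janowski_convex A B.
            cmod (log_inv_coeff f 2) - cmod (log_inv_coeff f 1) \<le> (A - B) / 12 \<and>
            cmod (log_inv_coeff f 1) - cmod (log_inv_coeff f 2) \<le> bound)
       \<and> (\<exists>f \<in> janowski_convex A B.
            cmod (log_inv_coeff f 2) - cmod (log_inv_coeff f 1) = (A - B) / 12)
       \<and> (\<exists>f \<in> janowski_convex A B.
            cmod (log_inv_coeff f 1) - cmod (log_inv_coeff f 2) = bound)"
proof (intro conjI ballI)
  note AB = assms(1-3)
  have bound: "bound = (A - B) / 12 * profile_bound \<bar>5 * A - B\<bar>"
  proof -
    have 1: "(A - B) / 4 * (1 - q / 12) = (A - B) / 12 * (3 - q / 4)" for q :: real
      by (simp add: field_simps)
    have 2: "c / (2 * s) = c / 12 * (6 / s)" for c s :: real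
      by (cases "s = 0") (simp_all add: field_simps)
    show ?thesis
      unfolding bound_def profile_bound_def
      by (simp only: 1 2 if_distrib[where f = "(*) ((A - B) / 12)"])
  qed
  {
    fix f assume f: "f \<in> janowski_convex A B"
    obtain \<phi> where \<phi>: "schwarz_datum A B \<phi>"
      and ode: "convex_ode f (janowski_preschwarzian A B \<phi>)"
      by (rule janowski_convexD[OF AB f])
    interpret schwarz_datum A B \<phi> by (rule \<phi>)
    let ?D = "cmod (deriv \<phi> 0 - of_real ((5 * A - B) / 4) * (\<phi> 0)\<^sup>2)"
    have "(A - B) / 12 * (?D - 3 * cmod (\<phi> 0)) \<le> (A - B) / 12 * 1"
      using functional_bounds(1) AB by (intro mult_left_mono) auto
    then show "cmod (log_inv_coeff f 2) - cmod (log_inv_coeff f 1) \<le> (A - B) / 12"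
      unfolding log_inv_coeffs[OF ode] by (simp only: right_diff_distrib mult_1_right)
    have "(A - B) / 12 * (3 * cmod (\<phi> 0) - ?D) \<le> bound"
      unfolding bound using functional_bounds(2) AB by (intro mult_left_mono) auto
    then show "cmod (log_inv_coeff f 1) - cmod (log_inv_coeff f 2) \<le> bound"
      unfolding log_inv_coeffs[OF ode] by (simp only: right_diff_distrib)
  }
  \<comment> \<open>Here \<open>\<omega> z\<close> is \<open>z\<^sup>2\<close> or \<open>- z\<^sup>2\<close>.\<close>
  obtain f where "f \<in> janowski_convex A B"
    "cmod (log_inv_coeff f 1) = (A - B) / 12 * (3 * 0)"
    "cmod (log_inv_coeff f 2) = (A - B) / 12 * \<bar>(\<bar>5 * A - B\<bar> + 4) / 4 * 0\<^sup>2 - 1\<bar>"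
    by (rule janowski_extremal[OF AB order_refl zero_le_one])
  then show "\<exists>f \<in> janowski_convex A B.
      cmod (log_inv_coeff f 2) - cmod (log_inv_coeff f 1) = (A - B) / 12"
    by (intro bexI[of _ f]) auto
  obtain x where x: "0 \<le> x" "x \<le> 1"
    and max: "3 * x - \<bar>(\<bar>5 * A - B\<bar> + 4) / 4 * x\<^sup>2 - 1\<bar> = profile_bound \<bar>5 * A - B\<bar>"
    by (rule profile_bound_attained[of "\<bar>5 * A - B\<bar>"]) auto
  obtain f where "f \<in> janowski_convex A B"
    "cmod (log_inv_coeff f 1) = (A - B) / 12 * (3 * x)"
    "cmod (log_inv_coeff f 2) = (A - B) / 12 * \<bar>(\<bar>5 * A - B\<bar> + 4) / 4 * x\<^sup>2 - 1\<bar>"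
    by (rule janowski_extremal[OF AB x])
  then show "\<exists>f \<in> janowski_convex A B.
      cmod (log_inv_coeff f 1) - cmod (log_inv_coeff f 2) = bound"
    by (intro bexI[of _ f]) (simp_all only: bound max[symmetric] right_diff_distrib)
qed

end
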